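(* Let $\mathcal{I}$ be an ideal on $\omega$. There exists an infinite real matrix $A\in(\ell_\infty,\ell_\infty)$ such that $$\mathrm{core}_{A\bm{x}}(\mathrm{Fin})=\mathrm{core}_{\bm{x}}(\mathcal{I})\quad\text{for all sequences }\bm{x}\in\ell_\infty$$ if and only if $\mathcal{I}=\mathrm{Fin}$ or $\mathcal{I}$ is an isomorphic copy of $\mathrm{Fin}\oplus\mathcal{P}(\omega)$ on $\omega$.
   Context: $\omega$ is the set of natural numbers (including $0$). An ideal $\mathcal{I}$ on $\omega$ is a family of subsets of $\omega$ closed under subsets and finite unions; it is always assumed that $\mathcal{I}$ contains the family $\mathrm{Fin}$ of all finite subsets of $\omega$ and that $\omega\notin\mathcal{I}$. Write $\mathcal{I}^\star:=\{S\subseteq\omega:\omega\setminus S\in\mathcal{I}\}$. $\mathrm{Fin}\oplus\mathcal{P}(\omega):=\{S\subseteq\{0,1\}\times\omega:|S\cap(\{0\}\times\omega)|<\infty\}$, an ideal on the countable set $\{0,1\}\times\omega$. An ideal $\mathcal{I}$ on $\omega$ is an isomorphic copy of it if there is a bijection $f:\omega\to\{0,1\}\times\omega$ such that, for every $S\subseteq\{0,1\}\times\omega$, $S\in\mathrm{Fin}\oplus\mathcal{P}(\omega)$ if and only if $f^{-1}[S]\in\mathcal{I}$. (The condition "$\mathcal{I}=\mathrm{Fin}$ or $\mathcal{I}$ is an isomorphic copy of $\mathrm{Fin}\oplus\mathcal{P}(\omega)$" is equivalent to: $\mathcal{I}=\{S\subseteq\omega:S\cap T\in\mathrm{Fin}\}$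 for some infinite $T\subseteq\omega$.) $\ell_\infty$ is the space of bounded real sequences indexed by $\omega$. For a real sequence $\bm{x}=(x_n:n\in\omega)$, its $\mathcal{I}$-core is $\mathrm{core}_{\bm{x}}(\mathcal{I}):=\bigcap_{S\in\mathcal{I}^\star}\overline{\mathrm{co}}\{x_n:n\in S\}$, where $\overline{\mathrm{co}}$ denotes the closed convex hull; for bounded $\bm{x}$ and $\mathcal{I}=\mathrm{Fin}$ this is the interval $[\liminf\bm{x},\limsup\bm{x}]$. For an infinite real matrix $A=(a_{n,k}:n,k\in\omega)$ and a real sequence $\bm{x}$, $A\bm{x}$ is the sequence whose $n$-th term is $\sum_{k\in\omega}a_{n,k}x_k$, defined if every such series converges to a real number. $A\in(\ell_\infty,\ell_\infty)$ means that $A\bm{x}$ is defined and bounded for all $\bm{x}\in\ell_\infty$. *)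

theory Defs
  imports "HOL-Analysis.Analysis"
begin

definition Fin :: "nat set set" where
  "Fin = {S. finite S}"

text \<open>Ideals on the natural numbers, always proper and containing all finite sets.\<close>

definition omega_ideal :: "nat set set \<Rightarrow> bool" where
  "omega_ideal I \<longleftrightarrow>
     (\<forall>S T. S \<in> I \<and> T \<subseteq> S \<longrightarrow> T \<in> I) \<and>
     (\<forall>S T. S \<in> I \<and> T \<in> I \<longrightarrow> S \<union> T \<in> I) \<and>
     Fin \<subseteq> I \<and> UNIV \<notin> I"

definition dual_filter :: "nat set set \<Rightarrow> nat set set" where
  "dual_filter I = {S. - S \<in> I}"

text \<open>
  The ideal \<open>Fin \<oplus> P(\<omega>)\<close> lives on the set \<open>{0,1} \<times> \<omega>\<close>, which is rendered as the
  carrier \<open>{0, 1} \<times> UNIV\<close> inside the type of pairs of natural numbers.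
\<close>

definition Fin_plus_Pow_carrier :: "(nat \<times> nat) set" where
  "Fin_plus_Pow_carrier = {0, 1} \<times> UNIV"

definition Fin_plus_Pow :: "(nat \<times> nat) set set" where
  "Fin_plus_Pow = {S. S \<subseteq> Fin_plus_Pow_carrier \<and> finite (S \<inter> ({0} \<times> UNIV))}"

definition isomorphic_copy_Fin_plus_Pow :: "nat set set \<Rightarrow> bool" where
  "isomorphic_copy_Fin_plus_Pow I \<longleftrightarrow>
     (\<exists>f :: nat \<Rightarrow> nat \<times> nat. bij_betw f UNIV Fin_plus_Pow_carrier \<and>
        (\<forall>S. S \<subseteq> Fin_plus_Pow_carrier \<longrightarrow> (S \<in> Fin_plus_Pow \<longleftrightarrow> f -` S \<in> I)))"

definition ell_infty :: "(nat \<Rightarrow> real) set" where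
  "ell_infty = {x. bounded (range x)}"

definition core :: "(nat \<Rightarrow> real) \<Rightarrow> nat set set \<Rightarrow> real set" where
  "core x I = (\<Inter>S\<in>dual_filter I. closure (convex hull (x ` S)))"

text \<open>
  \<open>mat_apply A x\<close> is meaningful only if \<open>mat_defined A x\<close> holds, since \<open>suminf\<close> is a total function.
\<close>

definition mat_defined :: "(nat \<Rightarrow> nat \<Rightarrow> real) \<Rightarrow> (nat \<Rightarrow> real) \<Rightarrow> bool" where
  "mat_defined A x \<longleftrightarrow> (\<forall>n. summable (\<lambda>k. A n k * x k))"

definition mat_apply :: "(nat \<Rightarrow> nat \<Rightarrow> real) \<Rightarrow> (nat \<Rightarrow> real) \<Rightarrow> nat \<Rightarrow> real" where
  "mat_apply A x = (\<lambda>n. \<Sum>k. A n k * x k)"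

definition matrix_class ::
  "(nat \<Rightarrow> real) set \<Rightarrow> (nat \<Rightarrow> real) set \<Rightarrow> (nat \<Rightarrow> nat \<Rightarrow> real) set" where
  "matrix_class X Y = {A. \<forall>x\<in>X. mat_defined A x \<and> mat_apply A x \<in> Y}"

end

theory Submission
  imports Defs
begin

text \<open>
  Both conditions on the ideal say that it consists of the sets \<open>S\<close> with \<open>S \<inter> T\<close> finite, for
  some infinite \<open>T\<close>. Given such \<open>T\<close>, the matrix that restricts a sequence to \<open>T\<close> preserves cores.
  Conversely, given \<open>A\<close>, let \<open>T\<close> be the set of columns having an entry of modulus above \<open>3/4\<close>.
  By a gliding hump argument (Schur), the mass that row \<open>n\<close> puts on a set of the ideal tends to \<open>0\<close>,
  so such a set meets \<open>T\<close> in a finite set. If a set outside the ideal had finite intersection with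
  \<open>T\<close>, one could pick in it finite blocks, seen by pairwise different rows, so sparse that every row
  sees essentially one block, and so small that no row sees mass above \<open>7/8\<close>, while each block
  carries mass \<open>1/8\<close> in some row. For the indicator \<open>x\<close> of the union of the blocks, \<open>A x\<close> then
  neither tends to \<open>0\<close> nor has \<open>1\<close> in its core, which is impossible.
\<close>

section \<open>Cores\<close>

lemma limit_in_core_Fin:
  assumes r: "strict_mono (r :: nat \<Rightarrow> nat)" and lim: "(y \<circ> r) \<longlonglongrightarrow> l"
  shows "l \<in> core y Fin"
  unfolding core_def
proof
  fix S assume "S \<in> dual_filter Fin"
  then have "finite (- S)"
    by (simp add: dual_filter_def Fin_def)
  then have "\<forall>\<^sub>F n in sequentially. n \<notin> - S"
    by (metis eventually_sequentially finite_nat_set_iff_bounded leD)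
  then have "\<forall>\<^sub>F n in sequentially. r n \<notin> - S"
    by (rule eventually_subseq[OF r])
  then have "\<forall>\<^sub>F n in sequentially. (y \<circ> r) n \<in> closure (convex hull (y ` S))"
    by (rule eventually_mono) (auto intro!: closure_subset[THEN subsetD] hull_inc)
  then show "l \<in> closure (convex hull (y ` S))"
    using Lim_in_closed_set[OF closed_closure _ sequentially_bot lim] by blast
qed

text \<open>Bolzano-Weierstrass: terms staying at distance \<open>e\<close> from 0 accumulate, by
  boundedness, at a nonzero point of the core.\<close>

lemma core_Fin_zero_imp_tendsto:
  assumes "y \<in> ell_infty" and core: "core y Fin \<subseteq> {0}"
  shows "y \<longlonglongrightarrow> 0"
proof (rule ccontr)
  assume "\<not> y \<longlonglongrightarrow> 0"
  then obtain e where "e > 0" and e: "\<exists>\<^sub>F n in sequentially. e \<le> \<bar>y n\<bar>"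
    unfolding tendsto_iff frequently_def by (auto simp: not_less[symmetric])
  have inf: "infinite {n. e \<le> \<bar>y n\<bar>}"
    using e by (simp add: frequently_sequentially infinite_nat_iff_unbounded_le)
  define r where "r = enumerate {n. e \<le> \<bar>y n\<bar>}"
  have r: "strict_mono r" "\<And>n. e \<le> \<bar>y (r n)\<bar>"
    using strict_mono_enumerate[OF inf] enumerate_in_set[OF inf] by (auto simp: r_def)
  have "bounded (range (y \<circ> r))"
    using assms(1) by (auto simp: ell_infty_def intro: bounded_subset)
  then obtain l s where s: "strict_mono s" "(y \<circ> r \<circ> s) \<longlonglongrightarrow> l"
    using bounded_imp_convergent_subsequence by blast
  have "strict_mono (r \<circ> s)"
    using r s by (simp add: strict_mono_o)
  then have "l \<in> core y Fin"
    using limit_in_core_Fin s(2) by (simp add: o_assoc)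
  moreover have "e \<le> \<bar>l\<bar>"
    by (rule LIMSEQ_le_const[OF tendsto_rabs[OF s(2)]]) (simp add: r)
  ultimately show False
    using \<open>e > 0\<close> core by auto
qed

text \<open>A tail bounded above by \<open>c\<close> would confine the whole core to
  \<open>{..c}\<close>.\<close>

lemma core_Fin_frequently_greater:
  assumes "u \<in> core y Fin" and "c < u"
  shows "\<exists>\<^sub>F n in sequentially. c < y n"
proof (rule ccontr)
  assume "\<not> ?thesis"
  then obtain N where N: "\<And>n. n \<ge> N \<Longrightarrow> y n \<le> c"
    by (auto simp: not_frequently eventually_sequentially not_less)
  have "- {N..} = {..<N}" by auto
  then have "{N..} \<in> dual_filter Fin"
    by (simp add: dual_filter_def Fin_def)
  then have "u \<in> closure (convex hull (y ` {N..}))"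
    using assms(1) unfolding core_def by blast
  moreover have "closure (convex hull (y ` {N..})) \<subseteq> {..c}"
    by (intro closure_minimal hull_minimal) (auto simp: N)
  ultimately show False
    using assms(2) by auto
qed

lemma core_subset_zero:
  assumes "S \<in> I" and "\<And>k. k \<notin> S \<Longrightarrow> x k = 0"
  shows "core x I \<subseteq> {0}"
proof -
  have "- S \<in> dual_filter I"
    using assms(1) by (simp add: dual_filter_def)
  moreover have "closure (convex hull (x ` (- S))) \<subseteq> {0}"
    by (intro closure_minimal hull_minimal) (auto simp: assms(2))
  ultimately show ?thesis
    unfolding core_def by blast
qed

text \<open>\<open>S\<close> meets every set of the dual filter, since otherwise it would lie inside
  a set of the ideal; so the indicator takes the value 1 on each of them.\<close>

lemma one_in_core_indicator:
  assumes "omega_ideal I" and "S \<notin> I"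
  shows "1 \<in> core (indicator S) I"
  unfolding core_def
proof
  fix R assume "R \<in> dual_filter I"
  then have "\<not> S \<subseteq> - R"
    using assms by (auto simp: dual_filter_def omega_ideal_def)
  then obtain k where "k \<in> S" "k \<in> R" by auto
  then have "1 \<in> (indicator S :: nat \<Rightarrow> real) ` R"
    by (intro image_eqI[of _ _ k]) auto
  then show "1 \<in> closure (convex hull ((indicator S :: nat \<Rightarrow> real) ` R))"
    by (intro closure_subset[THEN subsetD] hull_inc)
qed

section \<open>Restriction to an infinite set\<close>

definition restr_ideal :: "nat set \<Rightarrow> nat set set" where
  "restr_ideal T = {S. finite (S \<inter> T)}"

text \<open>If \<open>T\<close> is cofinite, intersecting with it does not affect finiteness.
  Otherwise \<open>T\<close> and its complement are both infinite and supply the two copies of the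
  natural numbers.\<close>

lemma restr_ideal_cases:
  assumes "infinite T"
  shows "restr_ideal T = Fin \<or> isomorphic_copy_Fin_plus_Pow (restr_ideal T)"
proof (cases "finite (- T)")
  case True
  have "finite S" if "finite (S \<inter> T)" for S
    using that True by (intro finite_subset[of S "(S \<inter> T) \<union> - T"]) auto
  then have "finite (S \<inter> T) \<longleftrightarrow> finite S" for S
    by blast
  then show ?thesis
    by (simp add: restr_ideal_def Fin_def)
next
  case False
  define f where "f k = (if k \<in> T then (0::nat, to_nat_on T k) else (1, to_nat_on (- T) k))" for k
  have T: "bij_betw (to_nat_on T) T UNIV" and cT: "bij_betw (to_nat_on (- T)) (- T) UNIV"
    using assms False by (auto intro!: to_nat_on_infinite)
  have inj: "inj f"
    using bij_betw_imp_inj_on[OF T] bij_betw_imp_inj_on[OF cT]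
    by (intro injI) (force simp: f_def dest: inj_onD split: if_splits)
  have "(i, m) \<in> range f" if "i = 0 \<or> i = 1" for i m
  proof -
    obtain k l where "k \<in> T" "to_nat_on T k = m" "l \<notin> T" "to_nat_on (- T) l = m"
      using bij_betw_imp_surj_on[OF T] bij_betw_imp_surj_on[OF cT] by (metis ComplD UNIV_I imageE)
    then have "f k = (0, m)" "f l = (1, m)"
      by (auto simp: f_def)
    then show ?thesis
      using that by (metis rangeI)
  qed
  then have bij: "bij_betw f UNIV Fin_plus_Pow_carrier"
    using inj by (auto simp: bij_betw_def Fin_plus_Pow_carrier_def f_def)
  have "S \<in> Fin_plus_Pow \<longleftrightarrow> f -` S \<in> restr_ideal T" if S: "S \<subseteq> Fin_plus_Pow_carrier" for S
  proof -
    have "f ` (f -` S \<inter> T) = S \<inter> {0} \<times> UNIV"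
    proof
      show "S \<inter> {0} \<times> UNIV \<subseteq> f ` (f -` S \<inter> T)"
      proof
        fix p assume p: "p \<in> S \<inter> {0} \<times> UNIV"
        then obtain k where "p = f k"
          using S bij unfolding bij_betw_def by blast
        with p show "p \<in> f ` (f -` S \<inter> T)"
          by (auto simp: f_def split: if_splits)
      qed
    qed (auto simp: f_def)
    then show ?thesis
      using S finite_image_iff[OF inj_on_subset[OF inj subset_UNIV], of "f -` S \<inter> T"]
      by (simp add: Fin_plus_Pow_def restr_ideal_def)
  qed
  with bij show ?thesis
    unfolding isomorphic_copy_Fin_plus_Pow_def by blast
qed

lemma Fin_eq_restr_ideal: "Fin = restr_ideal UNIV"
  by (simp add: Fin_def restr_ideal_def)

text \<open>\<open>T\<close> is the part that \<open>f\<close> sends to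
  \<open>{0} \<times> UNIV\<close>, the only column on which finiteness is demanded.\<close>

lemma isomorphic_copy_imp_restr_ideal:
  assumes "isomorphic_copy_Fin_plus_Pow I"
  obtains T where "infinite T" and "I = restr_ideal T"
proof -
  obtain f where bij: "bij_betw f UNIV Fin_plus_Pow_carrier"
    and f: "\<And>S. S \<subseteq> Fin_plus_Pow_carrier \<Longrightarrow> S \<in> Fin_plus_Pow \<longleftrightarrow> f -` S \<in> I"
    using assms unfolding isomorphic_copy_Fin_plus_Pow_def by blast
  define T where "T = f -` ({0} \<times> UNIV)"
  have inj: "inj f"
    using bij by (simp add: bij_betw_def)
  have "{0} \<times> UNIV \<subseteq> range f"
    using bij by (auto simp: bij_betw_def Fin_plus_Pow_carrier_def)
  then have "f ` T = {0} \<times> UNIV"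
    unfolding T_def by (simp add: image_vimage_eq inf.absorb1)
  then have "infinite T"
    by (metis finite_cartesian_productD2 finite_imageI infinite_UNIV_nat insert_not_empty)
  moreover have "S \<in> I \<longleftrightarrow> finite (S \<inter> T)" for S
  proof -
    have carrier: "f ` S \<subseteq> Fin_plus_Pow_carrier"
      using bij by (auto simp: bij_betw_def)
    have "S \<in> I \<longleftrightarrow> finite (f ` S \<inter> {0} \<times> UNIV)"
      using f[OF carrier] carrier inj_vimage_image_eq[OF inj, of S] by (simp add: Fin_plus_Pow_def)
    also have "f ` S \<inter> {0} \<times> UNIV = f ` (S \<inter> T)"
      unfolding T_def by blast
    finally show ?thesis
      using finite_image_iff[OF inj_on_subset[OF inj subset_UNIV]] by simp
  qed
  ultimately show thesis
    using that by (auto simp: restr_ideal_def)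
qed

text \<open>Preimages under \<open>enumerate T\<close> of sets containing almost all of
  \<open>T\<close> are cofinite, and images of cofinite sets contain almost all of \<open>T\<close>.
  Each of these facts gives one inclusion.\<close>

lemma core_enumerate:
  assumes "infinite T"
  shows "core (\<lambda>n. x (enumerate T n)) Fin = core x (restr_ideal T)"
proof
  let ?e = "enumerate T"
  have inj: "inj ?e" and range: "range ?e = T"
    using bij_enumerate[OF assms] by (auto simp: bij_betw_def)
  show "core (\<lambda>n. x (?e n)) Fin \<subseteq> core x (restr_ideal T)"
    unfolding core_def
  proof (rule INF_greatest)
    fix S assume "S \<in> dual_filter (restr_ideal T)"
    then have "finite (- S \<inter> T)"
      by (simp add: dual_filter_def restr_ideal_def)
    then have "finite (?e -` (- S \<inter> T))"
      by (rule finite_vimageI[OF _ inj])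
    moreover have "- (?e -` S) = ?e -` (- S \<inter> T)"
      using range by auto
    ultimately have "?e -` S \<in> dual_filter Fin"
      by (simp add: dual_filter_def Fin_def)
    moreover have "closure (convex hull ((\<lambda>n. x (?e n)) ` (?e -` S))) \<subseteq> closure (convex hull (x ` S))"
      by (intro closure_mono hull_mono) auto
    ultimately show "(\<Inter>S\<in>dual_filter Fin. closure (convex hull ((\<lambda>n. x (?e n)) ` S)))
        \<subseteq> closure (convex hull (x ` S))"
      by blast
  qed
  show "core x (restr_ideal T) \<subseteq> core (\<lambda>n. x (?e n)) Fin"
    unfolding core_def
  proof (rule INF_greatest)
    fix S assume "S \<in> dual_filter Fin"
    then have "finite (- S)"
      by (simp add: dual_filter_def Fin_def)
    moreover have "- (?e ` S) \<inter> T = ?e ` (- S)"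
      using image_set_diff[OF inj, of UNIV S] range by (auto simp: Compl_eq_Diff_UNIV)
    ultimately have "?e ` S \<in> dual_filter (restr_ideal T)"
      by (simp add: dual_filter_def restr_ideal_def)
    moreover have "(\<lambda>n. x (?e n)) ` S = x ` ?e ` S"
      by auto
    ultimately show "(\<Inter>S\<in>dual_filter (restr_ideal T). closure (convex hull (x ` S)))
        \<subseteq> closure (convex hull ((\<lambda>n. x (?e n)) ` S))"
      by auto
  qed
qed

lemma restr_ideal_core_preserved:
  assumes "infinite T"
  shows "\<exists>A \<in> matrix_class ell_infty ell_infty.
           \<forall>x \<in> ell_infty. core (mat_apply A x) Fin = core x (restr_ideal T)"
proof
  let ?A = "\<lambda>n k. if k = enumerate T n then 1 else 0 :: real"
  have sums: "(\<lambda>k. ?A n k * x k) sums x (enumerate T n)" for n x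
    using sums_If_finite_set[of "{enumerate T n}" x] by (simp add: if_distrib if_distribR cong: if_cong)
  have app: "mat_apply ?A x = (\<lambda>n. x (enumerate T n))" for x
    unfolding mat_apply_def using sums by (auto intro!: sums_unique[symmetric])
  have "bounded (range (\<lambda>n. x (enumerate T n)))" if "bounded (range x)" for x :: "nat \<Rightarrow> real"
    using that by (rule bounded_subset) auto
  then show "?A \<in> matrix_class ell_infty ell_infty"
    using sums by (auto simp: matrix_class_def mat_defined_def app ell_infty_def intro: sums_summable)
  show "\<forall>x \<in> ell_infty. core (mat_apply ?A x) Fin = core x (restr_ideal T)"
    by (simp add: app core_enumerate[OF assms])
qed

section \<open>The gliding hump\<close>

text \<open>Tails are measured by arbitrary finite sets, because the humps below need not be
  intervals; nonnegativity lets an interval dominate \<open>F\<close>.\<close>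

lemma summable_small_tail:
  fixes b :: "nat \<Rightarrow> real"
  assumes "summable b" and "\<And>k. 0 \<le> b k" and "e > 0"
  obtains K where "\<And>F. finite F \<Longrightarrow> F \<subseteq> {K..} \<Longrightarrow> sum b F \<le> e"
proof -
  obtain K where K: "\<And>m n. m \<ge> K \<Longrightarrow> norm (sum b {m..<n}) < e"
    using assms(1,3) unfolding summable_Cauchy by blast
  have "sum b F \<le> e" if "finite F" "F \<subseteq> {K..}" for F
  proof -
    obtain m where "F \<subseteq> {..<m}"
      using \<open>finite F\<close> finite_nat_bounded by blast
    then have "sum b F \<le> sum b {K..<m}"
      using that assms(2) by (intro sum_mono2) auto
    also have "\<dots> \<le> e"
      using K[of K m] by auto
    finally show ?thesis .
  qed
  then show thesis using that by blast
qed

text \<open>Later \<open>b n k\<close> is \<open>\<bar>A n k\<bar>\<close>. The mass of a row on a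
  set is always expressed through sums over finite subsets.\<close>

locale null_columns =
  fixes b :: "nat \<Rightarrow> nat \<Rightarrow> real"
  assumes nonneg: "0 \<le> b n k"
    and rows: "summable (b n)"
    and columns: "(\<lambda>n. b n k) \<longlonglongrightarrow> 0"
begin

lemma eventually_sum_le:
  assumes "e > 0"
  shows "\<forall>\<^sub>F n in sequentially. sum (b n) F \<le> e"
proof -
  have "(\<lambda>n. sum (b n) F) \<longlonglongrightarrow> 0"
    using tendsto_sum[of F "\<lambda>k n. b n k" "\<lambda>_. 0"] columns by simp
  then have "\<forall>\<^sub>F n in sequentially. sum (b n) F < e"
    using assms by (rule order_tendstoD(2))
  then show ?thesis
    by (rule eventually_mono) simp
qed

lemma uniform_tail:
  assumes "e > 0"
  shows "\<exists>K\<ge>K0. \<forall>n<(M::nat). \<forall>F. finite F \<longrightarrow> F \<subseteq> {K..} \<longrightarrow> sum (b n) F \<le> e"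
proof -
  have "\<exists>K. \<forall>F. finite F \<longrightarrow> F \<subseteq> {K..} \<longrightarrow> sum (b n) F \<le> e" for n
    using summable_small_tail[OF rows nonneg assms] by metis
  then obtain \<kappa> where \<kappa>: "\<And>n F. finite F \<Longrightarrow> F \<subseteq> {\<kappa> n..} \<Longrightarrow> sum (b n) F \<le> e"
    by metis
  define K where "K = Max (insert K0 (\<kappa> ` {..<M}))"
  have "K0 \<le> K" "\<And>n. n < M \<Longrightarrow> \<kappa> n \<le> K"
    by (auto simp: K_def)
  then show ?thesis
    using \<kappa> by (metis atLeast_subset_iff subset_trans)
qed

text \<open>The blocks are built from left to right. Each is followed by a row bound
  \<open>M\<close>, past which the columns used so far are nearly null, and then by a column bound
  \<open>K'\<close>, past which the rows before \<open>M\<close> are nearly null; the next block is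
  sought from \<open>K'\<close> on.\<close>

lemma gliding_hump:
  assumes P: "\<And>K. \<exists>G. finite G \<and> G \<subseteq> {K..} \<and> P G" and "e > 0"
  obtains G :: "nat \<Rightarrow> nat set"
  where "\<And>j. finite (G j)" and "\<And>j. P (G j)" and "\<And>i j. i \<noteq> j \<Longrightarrow> G i \<inter> G j = {}"
    and "\<And>n. \<exists>j. \<forall>F. finite F \<longrightarrow> F \<subseteq> (\<Union>i. G i) - G j \<longrightarrow> sum (b n) F \<le> e"
proof -
  \<comment> \<open>One step of the recursion, with \<open>K\<close> the first free column. The two
    bounds \<open>e/2\<close> serve the blocks before and after the exempt one, and
    \<open>j < M\<close> makes every row lie before some row bound.\<close>
  define Q where "Q j K G M K' \<longleftrightarrow> finite G \<and> G \<subseteq> {K..<K'} \<and> P G \<and> K \<le> K' \<and> j < M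
      \<and> (\<forall>n\<ge>M. sum (b n) ({..<K} \<union> G) \<le> e/2)
      \<and> (\<forall>n<M. \<forall>F. finite F \<longrightarrow> F \<subseteq> {K'..} \<longrightarrow> sum (b n) F \<le> e/2)"
    for j K M K' :: nat and G
  have "\<exists>G M K'. Q j K G M K'" for j K
  proof -
    obtain G where G: "finite G" "G \<subseteq> {K..}" "P G"
      using P by blast
    obtain M0 where M0: "\<And>n. n \<ge> M0 \<Longrightarrow> sum (b n) ({..<K} \<union> G) \<le> e/2"
      using eventually_sum_le[of "e/2" "{..<K} \<union> G"] \<open>e > 0\<close> by (auto simp: eventually_sequentially)
    define M where "M = max M0 (Suc j)"
    obtain L where L: "G \<subseteq> {..<L}"
      using G(1) finite_nat_bounded by blast
    obtain K' where K': "max K L \<le> K'"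
        "\<forall>n<M. \<forall>F. finite F \<longrightarrow> F \<subseteq> {K'..} \<longrightarrow> sum (b n) F \<le> e/2"
      using uniform_tail[of "e/2" "max K L" M] \<open>e > 0\<close> by auto
    have "G \<subseteq> {K..<K'}"
      using G(2) L K'(1) by force
    moreover have "M > j" "\<forall>n\<ge>M. sum (b n) ({..<K} \<union> G) \<le> e/2" "K \<le> K'"
      using M0 K'(1) by (auto simp: M_def)
    ultimately show ?thesis
      unfolding Q_def using G K'(2) by blast
  qed
  then obtain g m h where step: "\<And>j K. Q j K (g j K) (m j K) (h j K)"
    by metis
  \<comment> \<open>\<open>h\<close> returns the next free column, so iterating it from 0 yields the
    starting columns of all steps.\<close>
  define K where "K = rec_nat 0 h"
  define G where "G j = g j (K j)" for j
  define M where "M j = m j (K j)" for j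
  have KSuc: "K (Suc j) = h j (K j)" for j
    by (simp add: K_def)
  have G: "finite (G j)" "G j \<subseteq> {K j..<K (Suc j)}" "P (G j)" "j < M j" for j
    using step[of j "K j"] by (auto simp: Q_def G_def M_def KSuc)
  have head: "sum (b n) ({..<K j} \<union> G j) \<le> e/2" if "M j \<le> n" for j n
    using step[of j "K j"] that by (auto simp: Q_def G_def M_def)
  have tail: "sum (b n) F \<le> e/2" if "n < M j" "finite F" "F \<subseteq> {K (Suc j)..}" for j n F
    using step[of j "K j"] that by (auto simp: Q_def M_def KSuc)
  have "mono K"
    using step by (simp add: Q_def mono_iff_le_Suc KSuc)
  then have Kmono: "K i \<le> K j" if "i \<le> j" for i j
    using that by (rule monoD)
  have below: "G i \<subseteq> {..<K j}" if "i < j" for i j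
    using G(2)[of i] Kmono[of "Suc i" j] that by force
  have above: "G i \<subseteq> {K (Suc j)..}" if "j < i" for i j
    using G(2)[of i] Kmono[of "Suc j" i] that by force
  have disj: "G i \<inter> G j = {}" if "i < j" for i j
    using below[OF that] G(2)[of j] by force
  show thesis
  proof (rule that[of G])
    show "G i \<inter> G j = {}" if "i \<noteq> j" for i j
      using disj[of i j] disj[of j i] that by (metis Int_commute linorder_neqE_nat)
    fix n
    \<comment> \<open>The block belonging to row \<open>n\<close> is the first one after which the row is small.\<close>
    define j where "j = (LEAST j. n < M j)"
    have j: "n < M j"
      unfolding j_def using G(4) by (rule LeastI)
    have sub: "sum (b n) F \<le> e" if F: "finite F" "F \<subseteq> (\<Union>i. G i) - G j" for F
    proof -
      let ?F1 = "F \<inter> (\<Union>i\<in>{..<j}. G i)" and ?F2 = "F \<inter> (\<Union>i\<in>{j<..}. G i)"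
      have "F = ?F1 \<union> ?F2"
      proof
        show "F \<subseteq> ?F1 \<union> ?F2"
        proof
          fix k assume "k \<in> F"
          then obtain i where "k \<in> G i" "i \<noteq> j"
            using F(2) by blast
          with \<open>k \<in> F\<close> show "k \<in> ?F1 \<union> ?F2"
            by (cases "i < j") auto
        qed
      qed auto
      then have "sum (b n) F \<le> sum (b n) ?F1 + sum (b n) ?F2"
        using sum_Un[of ?F1 ?F2 "b n"] sum_nonneg[of "?F1 \<inter> ?F2" "b n"] F(1) nonneg by simp
      moreover have "sum (b n) ?F1 \<le> e/2"
      proof (cases j)
        case 0
        then show ?thesis using \<open>e > 0\<close> by simp
      next
        case (Suc i)
        \<comment> \<open>By minimality of \<open>j\<close>, row \<open>n\<close> lies past the row
          bound of the preceding step \<open>i\<close>, whose head estimate covers all blocks up to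
          \<open>i\<close>.\<close>
        have "\<not> n < M i"
          using Suc not_less_Least[of i "\<lambda>j. n < M j"] by (simp add: j_def)
        moreover have "?F1 \<subseteq> {..<K i} \<union> G i"
          using below Suc by (force simp: less_Suc_eq)
        then have "sum (b n) ?F1 \<le> sum (b n) ({..<K i} \<union> G i)"
          using G(1) nonneg by (intro sum_mono2) auto
        ultimately show ?thesis
          using head[of i n] by simp
      qed
      moreover have "sum (b n) ?F2 \<le> e/2"
        using above F(1) by (intro tail[OF j]) auto
      ultimately show ?thesis by simp
    qed
    then show "\<exists>j. \<forall>F. finite F \<longrightarrow> F \<subseteq> (\<Union>i. G i) - G j \<longrightarrow> sum (b n) F \<le> e"
      by blast
  qed (use G in auto)
qed

text \<open>The first \<open>K\<close> columns eventually take up at most half of the mass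
  \<open>c\<close>, so in some row the other half lies beyond them. This supplies the blocks for the
  gliding hump.\<close>

lemma frequently_mass_imp_block:
  assumes freq: "\<exists>\<^sub>F n in sequentially. \<exists>F. finite F \<and> F \<subseteq> S \<and> c < sum (b n) F" and "c > 0"
  shows "\<exists>G. finite G \<and> G \<subseteq> {K..} \<and> G \<subseteq> S \<and> (\<exists>n. c/2 \<le> sum (b n) G)"
proof -
  have "\<forall>\<^sub>F n in sequentially. sum (b n) {..<K} \<le> c/2"
    using \<open>c > 0\<close> by (intro eventually_sum_le) simp
  with freq have "\<exists>\<^sub>F n in sequentially. (\<exists>F. finite F \<and> F \<subseteq> S \<and> c < sum (b n) F) \<and> sum (b n) {..<K} \<le> c/2"
    by (rule frequently_eventually_frequently)
  then obtain n F where F: "finite F" "F \<subseteq> S" "c < sum (b n) F" and n: "sum (b n) {..<K} \<le> c/2"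
    by (auto dest: frequently_ex)
  have "sum (b n) F = sum (b n) (F \<inter> {K..}) + sum (b n) (F - {K..})"
    using F(1) by (simp add: sum.Int_Diff)
  moreover have "sum (b n) (F - {K..}) \<le> sum (b n) {..<K}"
    using nonneg by (intro sum_mono2) auto
  ultimately have "c/2 \<le> sum (b n) (F \<inter> {K..})"
    using F(3) n by simp
  with F show ?thesis
    by (intro exI[of _ "F \<inter> {K..}"]) auto
qed

text \<open>Different blocks are seen by different rows, as a row sees no more than one of them.\<close>
lemma gliding_hump_rows:
  assumes P: "\<And>K. \<exists>G. finite G \<and> G \<subseteq> {K..} \<and> P G \<and> (\<exists>n. c \<le> sum (b n) G)" and "0 < e" "e < c"
  obtains G :: "nat \<Rightarrow> nat set" and r :: "nat \<Rightarrow> nat"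
  where "\<And>j. finite (G j)" and "\<And>j. P (G j)" and "\<And>i j. i \<noteq> j \<Longrightarrow> G i \<inter> G j = {}"
    and "\<And>n. \<exists>j. \<forall>F. finite F \<longrightarrow> F \<subseteq> (\<Union>i. G i) - G j \<longrightarrow> sum (b n) F \<le> e"
    and "inj r" and "\<And>j. c \<le> sum (b (r j)) (G j)"
    and "\<And>j F. finite F \<Longrightarrow> F \<subseteq> (\<Union>i. G i) - G j \<Longrightarrow> sum (b (r j)) F \<le> e"
proof -
  obtain G :: "nat \<Rightarrow> nat set" where G: "\<And>j. finite (G j)" "\<And>j. P (G j) \<and> (\<exists>n. c \<le> sum (b n) (G j))"
      "\<And>i j. i \<noteq> j \<Longrightarrow> G i \<inter> G j = {}"
      "\<And>n. \<exists>j. \<forall>F. finite F \<longrightarrow> F \<subseteq> (\<Union>i. G i) - G j \<longrightarrow> sum (b n) F \<le> e"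
    using gliding_hump[of "\<lambda>G. P G \<and> (\<exists>n. c \<le> sum (b n) G)" e] P \<open>0 < e\<close> by auto
  then obtain r where r: "\<And>j. c \<le> sum (b (r j)) (G j)"
    by metis
  \<comment> \<open>As \<open>e < c\<close>, any block on which a row has mass \<open>c\<close> must
    be the one exempted for that row. This makes \<open>r\<close> injective and shows that the block
    exempted for row \<open>r j\<close> is \<open>G j\<close>.\<close>
  have only: "i = j" if "\<forall>F. finite F \<longrightarrow> F \<subseteq> (\<Union>i. G i) - G i \<longrightarrow> sum (b n) F \<le> e"
      and "c \<le> sum (b n) (G j)" for i j n
  proof (rule ccontr)
    assume "i \<noteq> j"
    then have "G j \<subseteq> (\<Union>i. G i) - G i"
      using G(3)[of i j] by blast
    then have "sum (b n) (G j) \<le> e"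
      using that(1) G(1) by blast
    then show False
      using that(2) \<open>e < c\<close> by simp
  qed
  show thesis
  proof (rule that[of G r])
    show "inj r"
      by (rule injI) (metis G(4) only r)
    show "sum (b (r j)) F \<le> e" if "finite F" "F \<subseteq> (\<Union>i. G i) - G j" for j F
    proof -
      obtain i where i: "\<forall>F. finite F \<longrightarrow> F \<subseteq> (\<Union>i. G i) - G i \<longrightarrow> sum (b (r j)) F \<le> e"
        using G(4) by blast
      then have "i = j"
        using r by (rule only)
      then show ?thesis
        using i that by blast
    qed
  qed (use G r in auto)
qed

end

section \<open>Finiteness of the set of large terms, and trimming of finite sets\<close>

lemma tendsto_imp_finite_ge:
  fixes y :: "nat \<Rightarrow> real"
  assumes "y \<longlonglongrightarrow> 0" and "e > 0"
  shows "finite {n. e \<le> y n}"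
proof -
  have "\<forall>\<^sub>F n in sequentially. y n < e"
    using assms by (rule order_tendstoD(2))
  then obtain N where "\<And>n. n \<ge> N \<Longrightarrow> y n < e"
    by (auto simp: eventually_sequentially)
  then have "{n. e \<le> y n} \<subseteq> {..<N}"
    by (force simp: not_le[symmetric])
  then show ?thesis
    by (rule finite_subset) simp
qed

text \<open>In a minimal \<open>G\<close> that still reaches \<open>t\<close> in some row, removing
  one element brings every row below \<open>t\<close>, and that element contributes at most
  \<open>d\<close>.\<close>

lemma subset_with_moderate_sums:
  fixes b :: "nat \<Rightarrow> 'a \<Rightarrow> real"
  assumes "finite F" and "t \<le> sum (b n) F" and d: "\<And>n k. k \<in> F \<Longrightarrow> b n k \<le> d" and "0 \<le> t" "0 \<le> d"
  obtains G where "G \<subseteq> F" and "\<exists>n. t \<le> sum (b n) G" and "\<And>n. sum (b n) G \<le> t + d"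
proof -
  define Q where "Q = {G. G \<subseteq> F \<and> (\<exists>n. t \<le> sum (b n) G)}"
  have "finite Q" "Q \<noteq> {}"
    using assms(1,2) by (auto simp: Q_def)
  then obtain G where "G \<in> Q" and min: "\<And>H. H \<in> Q \<Longrightarrow> H \<subseteq> G \<Longrightarrow> G = H"
    using finite_has_minimal[of Q] by blast
  then have G: "G \<subseteq> F" "\<exists>n. t \<le> sum (b n) G"
    by (auto simp: Q_def)
  have "sum (b n) G \<le> t + d" for n
  proof (cases "G = {}")
    case False
    then obtain k where k: "k \<in> G" by blast
    then have "G - {k} \<notin> Q"
      using min[of "G - {k}"] by blast
    then have "\<not> t \<le> sum (b n) (G - {k})"
      using G(1) by (auto simp: Q_def)
    then have "sum (b n) (G - {k}) \<le> t"
      by simp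
    moreover have "sum (b n) G = b n k + sum (b n) (G - {k})"
      using G(1) k assms(1) by (intro sum.remove) (auto intro: finite_subset)
    moreover have "b n k \<le> d"
      using G(1) k d by blast
    ultimately show ?thesis by simp
  qed (use assms in simp)
  then show thesis
    using that G by blast
qed

section \<open>Matrices preserving cores\<close>

locale core_preserving =
  fixes I :: "nat set set" and A :: "nat \<Rightarrow> nat \<Rightarrow> real"
  assumes ideal: "omega_ideal I"
    and matrix: "A \<in> matrix_class ell_infty ell_infty"
    and core_eq: "x \<in> ell_infty \<Longrightarrow> core (mat_apply A x) Fin = core x I"
begin

lemma summable_row: "x \<in> ell_infty \<Longrightarrow> summable (\<lambda>k. A n k * x k)"
  using matrix by (auto simp: matrix_class_def mat_defined_def)

lemma ell_inftyI: "(\<And>k. \<bar>x k\<bar> \<le> 1) \<Longrightarrow> x \<in> ell_infty"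
  by (auto simp: ell_infty_def bounded_iff)

text \<open>Such an \<open>x\<close> vanishes on a set of the dual filter, which leaves no core
  point other than 0, for \<open>x\<close> and hence for its image.\<close>

lemma mat_apply_tendsto_zero:
  assumes "S \<in> I" and x: "x \<in> ell_infty" and "\<And>k. k \<notin> S \<Longrightarrow> x k = 0"
  shows "mat_apply A x \<longlonglongrightarrow> 0"
proof (rule core_Fin_zero_imp_tendsto)
  show "mat_apply A x \<in> ell_infty"
    using matrix x by (auto simp: matrix_class_def)
  show "core (mat_apply A x) Fin \<subseteq> {0}"
    using core_eq[OF x] core_subset_zero[of S I x] assms by simp
qed

sublocale null_columns "\<lambda>n k. \<bar>A n k\<bar>"
proof
  show "summable (\<lambda>k. \<bar>A n k\<bar>)" for n
  proof -
    \<comment> \<open>Testing on the signs of row \<open>n\<close> turns convergence into absolute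
      convergence.\<close>
    have "(\<lambda>k. sgn (A n k)) \<in> ell_infty"
      by (rule ell_inftyI) (simp add: sgn_if)
    from summable_row[OF this, of n] show ?thesis
      by (simp add: abs_sgn)
  qed
  show "(\<lambda>n. \<bar>A n k\<bar>) \<longlonglongrightarrow> 0" for k
  proof -
    \<comment> \<open>Singletons belong to the ideal, and \<open>A\<close> maps the indicator of
      \<open>{k}\<close> to column \<open>k\<close>.\<close>
    have "{k} \<in> I"
      using ideal by (auto simp: omega_ideal_def Fin_def)
    then have "mat_apply A (indicator {k}) \<longlonglongrightarrow> 0"
      by (rule mat_apply_tendsto_zero) (auto intro!: ell_inftyI simp: indicator_def)
    moreover have "mat_apply A (indicator {k}) n = A n k" for n
      unfolding mat_apply_def by (subst suminf_finite[of "{k}"]) (auto simp: indicator_def)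
    ultimately show ?thesis
      by (auto dest: tendsto_rabs_zero)
  qed
qed simp

text \<open>Schur's argument: otherwise blocks inside \<open>S\<close> carry mass \<open>c/2\<close>
  in pairwise different rows. A sequence supported on the blocks with matching signs then has an
  image that is at least \<open>c/2 - c/4\<close> in infinitely many rows, yet tends to 0.\<close>

lemma ideal_mass_le:
  assumes "S \<in> I" and "c > 0"
  shows "\<forall>\<^sub>F n in sequentially. \<forall>F. finite F \<longrightarrow> F \<subseteq> S \<longrightarrow> (\<Sum>k\<in>F. \<bar>A n k\<bar>) \<le> c"
proof (rule ccontr)
  assume "\<not> ?thesis"
  then have "\<exists>\<^sub>F n in sequentially. \<exists>F. finite F \<and> F \<subseteq> S \<and> c < (\<Sum>k\<in>F. \<bar>A n k\<bar>)"
    by (simp add: not_eventually not_le)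
  then have "\<exists>G. finite G \<and> G \<subseteq> {K..} \<and> G \<subseteq> S \<and> (\<exists>n. c/2 \<le> (\<Sum>k\<in>G. \<bar>A n k\<bar>))" for K
    using \<open>c > 0\<close> by (rule frequently_mass_imp_block)
  then obtain G :: "nat \<Rightarrow> nat set" and r :: "nat \<Rightarrow> nat"
    where G: "\<And>j. finite (G j)" "\<And>j. G j \<subseteq> S" "\<And>i j. i \<noteq> j \<Longrightarrow> G i \<inter> G j = {}"
      and r: "inj r" "\<And>j. c/2 \<le> (\<Sum>k\<in>G j. \<bar>A (r j) k\<bar>)"
      and small: "\<And>j F. finite F \<Longrightarrow> F \<subseteq> (\<Union>i. G i) - G j \<Longrightarrow> (\<Sum>k\<in>F. \<bar>A (r j) k\<bar>) \<le> c/4"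
    using \<open>c > 0\<close> by (rule_tac gliding_hump_rows[of "\<lambda>G. G \<subseteq> S" "c/2" "c/4"]) auto
  \<comment> \<open>Disjointness of the blocks makes \<open>THE j\<close> meaningful: on
    \<open>G j\<close> the sequence takes the signs of row \<open>r j\<close>.\<close>
  define x where "x k = (if k \<in> (\<Union>i. G i) then sgn (A (r (THE j. k \<in> G j)) k) else 0)" for k
  have x_G: "x k = sgn (A (r j) k)" if "k \<in> G j" for j k
  proof -
    have "(THE j. k \<in> G j) = j"
      using G(3) that by (intro the_equality) blast+
    then show ?thesis
      using that by (auto simp: x_def)
  qed
  have x_le: "\<bar>x k\<bar> \<le> 1" for k
    by (simp add: x_def sgn_if)
  then have x: "x \<in> ell_infty"
    by (rule ell_inftyI)
  have "mat_apply A x \<longlonglongrightarrow> 0"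
    using G(2) by (intro mat_apply_tendsto_zero[OF assms(1) x]) (auto simp: x_def)
  then have "finite {n. c/4 \<le> mat_apply A x n}"
    using \<open>c > 0\<close> by (intro tendsto_imp_finite_ge) auto
  moreover have "c/4 \<le> mat_apply A x (r j)" for j
  proof -
    obtain m where m: "G j \<subseteq> {..<m}"
      using G(1) finite_nat_bounded by blast
    \<comment> \<open>\<open>G j\<close> contributes at least \<open>c/2\<close>, the other blocks
      at most \<open>c/4\<close> in modulus, and \<open>x\<close> vanishes elsewhere. The bound then
      passes to the limit of the partial sums.\<close>
    have "c/4 \<le> (\<Sum>k<p. A (r j) k * x k)" if "p \<ge> m" for p
    proof -
      have "(\<Sum>k<p. A (r j) k * x k)
          = (\<Sum>k\<in>G j. A (r j) k * x k) + (\<Sum>k\<in>{..<p} - G j. A (r j) k * x k)"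
        using m that by (subst sum.subset_diff[of "G j"]) auto
      moreover have "(\<Sum>k\<in>G j. A (r j) k * x k) = (\<Sum>k\<in>G j. \<bar>A (r j) k\<bar>)"
        by (intro sum.cong) (auto simp: x_G abs_sgn)
      moreover have "\<bar>\<Sum>k\<in>{..<p} - G j. A (r j) k * x k\<bar> \<le> c/4"
      proof -
        let ?F = "{..<p} \<inter> ((\<Union>i. G i) - G j)"
        have "(\<Sum>k\<in>{..<p} - G j. A (r j) k * x k) = (\<Sum>k\<in>?F. A (r j) k * x k)"
          by (intro sum.mono_neutral_right) (auto simp: x_def)
        also have "\<bar>\<dots>\<bar> \<le> (\<Sum>k\<in>?F. \<bar>A (r j) k * x k\<bar>)"
          by (rule sum_abs)
        also have "\<dots> \<le> (\<Sum>k\<in>?F. \<bar>A (r j) k\<bar>)"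
          using x_le by (intro sum_mono) (simp add: abs_mult mult_left_le)
        also have "\<dots> \<le> c/4"
          by (intro small) auto
        finally show ?thesis .
      qed
      ultimately show ?thesis
        using r(2)[of j] by linarith
    qed
    moreover have "(\<lambda>p. \<Sum>k<p. A (r j) k * x k) \<longlonglongrightarrow> mat_apply A x (r j)"
      unfolding mat_apply_def by (rule summable_LIMSEQ[OF summable_row[OF x]])
    ultimately show ?thesis
      by (intro LIMSEQ_le_const) auto
  qed
  then have "range r \<subseteq> {n. c/4 \<le> mat_apply A x n}"
    by auto
  ultimately show False
    using r(1) finite_subset range_inj_infinite by blast
qed

text \<open>Some partial sum of the series already exceeds \<open>c\<close>, and dropping the signs
  cannot decrease it.\<close>

lemma mat_apply_indicator_greater:
  assumes "c < mat_apply A (indicator S) n"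
  shows "\<exists>F. finite F \<and> F \<subseteq> S \<and> c < (\<Sum>k\<in>F. \<bar>A n k\<bar>)"
proof -
  have "(indicator S :: nat \<Rightarrow> real) \<in> ell_infty"
    by (intro ell_inftyI) (simp add: indicator_def)
  then have "summable (\<lambda>k. A n k * indicator S k)"
    by (rule summable_row)
  then obtain p where "c < (\<Sum>k<p. A n k * indicator S k)"
    using assms suminf_le_const[of "\<lambda>k. A n k * indicator S k" c]
    by (force simp: mat_apply_def not_le[symmetric])
  also have "\<dots> = (\<Sum>k\<in>{..<p} \<inter> S. A n k)"
    by (simp add: indicator_def sum.inter_restrict if_distrib cong: if_cong)
  also have "\<dots> \<le> (\<Sum>k\<in>{..<p} \<inter> S. \<bar>A n k\<bar>)"
    by (intro sum_mono) simp
  finally show ?thesis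
    by (intro exI[of _ "{..<p} \<inter> S"]) simp
qed

text \<open>The image of the indicator has 1 in its core. Together with \<open>ideal_mass_le\<close>
  this leaves a gap: on a set of the ideal the mass tends to 0, on any other set it exceeds every
  \<open>c < 1\<close> infinitely often.\<close>

lemma positive_mass:
  assumes "S \<notin> I" and "c < 1"
  shows "\<exists>\<^sub>F n in sequentially. \<exists>F. finite F \<and> F \<subseteq> S \<and> c < (\<Sum>k\<in>F. \<bar>A n k\<bar>)"
proof -
  have "(indicator S :: nat \<Rightarrow> real) \<in> ell_infty"
    by (intro ell_inftyI) (simp add: indicator_def)
  then have "1 \<in> core (mat_apply A (indicator S)) Fin"
    using core_eq one_in_core_indicator[OF ideal assms(1)] by simp
  then have "\<exists>\<^sub>F n in sequentially. c < mat_apply A (indicator S) n"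
    using assms(2) by (rule core_Fin_frequently_greater)
  then show ?thesis
    by (rule frequently_elim1) (rule mat_apply_indicator_greater)
qed

text \<open>The constants of the second inclusion: entries off \<open>?T\<close> are at most 3/4, so
  blocks reaching 1/8 can be trimmed to mass at most 1/8 + 3/4 = 7/8 in every row, and the other
  blocks add at most 1/16. The total 15/16 < 1 forces the union of the blocks into the ideal, while
  1/8 > 1/16 keeps it out.\<close>

lemma ideal_eq_restr_ideal: "I = restr_ideal {k. \<exists>n. 3/4 < \<bar>A n k\<bar>}" (is "I = restr_ideal ?T")
proof
  show "I \<subseteq> restr_ideal ?T"
  proof
    fix S assume "S \<in> I"
    then obtain N where N: "\<And>n F. n \<ge> N \<Longrightarrow> finite F \<Longrightarrow> F \<subseteq> S \<Longrightarrow> (\<Sum>k\<in>F. \<bar>A n k\<bar>) \<le> 3/4"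
      using ideal_mass_le[of S "3/4"] by (auto simp: eventually_sequentially)
    \<comment> \<open>Rows from \<open>N\<close> on have mass at most 3/4 on \<open>S\<close>, so a
      column of \<open>S\<close> enters \<open>?T\<close> through an earlier row, and each row,
      being summable, has only finitely many large entries.\<close>
    have "S \<inter> ?T \<subseteq> (\<Union>n<N. {k. 3/4 \<le> \<bar>A n k\<bar>})"
    proof
      fix k assume "k \<in> S \<inter> ?T"
      then obtain n where "3/4 < \<bar>A n k\<bar>" "k \<in> S" by blast
      moreover from this have "n < N"
        using N[of n "{k}"] by (cases "n < N") auto
      ultimately show "k \<in> (\<Union>n<N. {k. 3/4 \<le> \<bar>A n k\<bar>})"
        by (intro UN_I[of n]) auto
    qed
    moreover have "finite {k. 3/4 \<le> \<bar>A n k\<bar>}" for n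
      by (rule tendsto_imp_finite_ge) (use summable_LIMSEQ_zero[OF rows] in auto)
    ultimately show "S \<in> restr_ideal ?T"
      unfolding restr_ideal_def by (intro CollectI) (rule finite_subset, auto intro!: finite_UN_I)
  qed
  show "restr_ideal ?T \<subseteq> I"
  proof (rule subsetI, rule ccontr)
    fix S assume "S \<in> restr_ideal ?T" "S \<notin> I"
    \<comment> \<open>The finite part inside \<open>?T\<close> belongs to the ideal, so the failure
      of \<open>S\<close> is due to columns without large entries.\<close>
    then have "S \<inter> ?T \<in> I"
      using ideal by (auto simp: omega_ideal_def Fin_def restr_ideal_def)
    then have "S - ?T \<notin> I"
      using \<open>S \<notin> I\<close> ideal unfolding omega_ideal_def by (metis Int_Diff_Un)
    \<comment> \<open>The threshold 1/4 is halved when the first columns are discarded, which leaves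
      the 1/8 required of a block.\<close>
    then have mass: "\<exists>\<^sub>F n in sequentially. \<exists>F. finite F \<and> F \<subseteq> S - ?T \<and> 1/4 < (\<Sum>k\<in>F. \<bar>A n k\<bar>)"
      by (rule positive_mass) simp
    have "\<exists>G. finite G \<and> G \<subseteq> {K..} \<and> (\<forall>n. (\<Sum>k\<in>G. \<bar>A n k\<bar>) \<le> 7/8)
        \<and> (\<exists>n. 1/8 \<le> (\<Sum>k\<in>G. \<bar>A n k\<bar>))" for K
    proof -
      obtain F n where F: "finite F" "F \<subseteq> {K..}" "F \<subseteq> S - ?T" "1/8 \<le> (\<Sum>k\<in>F. \<bar>A n k\<bar>)"
        using frequently_mass_imp_block[OF mass, of K] by auto
      have "\<bar>A n k\<bar> \<le> 3/4" if "k \<in> F" for n k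
      proof -
        have "k \<notin> ?T"
          using F(3) that by blast
        then show ?thesis
          by (simp add: not_less)
      qed
      then obtain G where "G \<subseteq> F" "\<exists>n. 1/8 \<le> (\<Sum>k\<in>G. \<bar>A n k\<bar>)"
          "\<And>n. (\<Sum>k\<in>G. \<bar>A n k\<bar>) \<le> 1/8 + 3/4"
        using subset_with_moderate_sums[of F "1/8" "\<lambda>n k. \<bar>A n k\<bar>" n "3/4"] F by auto
      with F show ?thesis
        by (intro exI[of _ G]) (auto intro: finite_subset)
    qed
    then obtain G :: "nat \<Rightarrow> nat set" and r :: "nat \<Rightarrow> nat"
      where G: "\<And>j. finite (G j)" "\<And>j n. (\<Sum>k\<in>G j. \<bar>A n k\<bar>) \<le> 7/8"
          "\<And>n. \<exists>j. \<forall>F. finite F \<longrightarrow> F \<subseteq> (\<Union>i. G i) - G j \<longrightarrow> (\<Sum>k\<in>F. \<bar>A n k\<bar>) \<le> 1/16"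
        and r: "inj r" "\<And>j. 1/8 \<le> (\<Sum>k\<in>G j. \<bar>A (r j) k\<bar>)"
      by (rule_tac gliding_hump_rows[of "\<lambda>G. \<forall>n. (\<Sum>k\<in>G. \<bar>A n k\<bar>) \<le> 7/8" "1/8" "1/16"]) auto
    define W where "W = (\<Union>i. G i)"
    have le: "(\<Sum>k\<in>F. \<bar>A n k\<bar>) \<le> 15/16" if F: "finite F" "F \<subseteq> W" for F n
    proof -
      obtain j where j: "\<And>F. finite F \<Longrightarrow> F \<subseteq> W - G j \<Longrightarrow> (\<Sum>k\<in>F. \<bar>A n k\<bar>) \<le> 1/16"
        using G(3)[of n] by (auto simp: W_def)
      have "(\<Sum>k\<in>F. \<bar>A n k\<bar>) = (\<Sum>k\<in>F \<inter> G j. \<bar>A n k\<bar>) + (\<Sum>k\<in>F - G j. \<bar>A n k\<bar>)"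
        using F(1) by (rule sum.Int_Diff)
      moreover have "(\<Sum>k\<in>F \<inter> G j. \<bar>A n k\<bar>) \<le> (\<Sum>k\<in>G j. \<bar>A n k\<bar>)"
        using G(1) by (intro sum_mono2) auto
      moreover have "(\<Sum>k\<in>F - G j. \<bar>A n k\<bar>) \<le> 1/16"
        using F by (intro j) auto
      ultimately show ?thesis
        using G(2)[of n j] by linarith
    qed
    have "W \<in> I"
    proof (rule ccontr)
      assume "W \<notin> I"
      then obtain n F where "finite F" "F \<subseteq> W" "15/16 < (\<Sum>k\<in>F. \<bar>A n k\<bar>)"
        using frequently_ex[OF positive_mass[of W "15/16"]] by auto
      then show False
        using le[of F n] by simp
    qed
    then obtain N where N: "\<And>n F. n \<ge> N \<Longrightarrow> finite F \<Longrightarrow> F \<subseteq> W \<Longrightarrow> (\<Sum>k\<in>F. \<bar>A n k\<bar>) \<le> 1/16"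
      using ideal_mass_le[of W "1/16"] by (auto simp: eventually_sequentially)
    have "r j < N" for j
    proof (rule ccontr)
      assume "\<not> r j < N"
      then have "(\<Sum>k\<in>G j. \<bar>A (r j) k\<bar>) \<le> 1/16"
        using N[of "r j" "G j"] G(1) by (auto simp: W_def)
      then show False
        using r(2)[of j] by linarith
    qed
    then have "range r \<subseteq> {..<N}"
      by auto
    then show False
      using r(1) finite_subset range_inj_infinite by blast
  qed
qed

end

theorem theorem2p5:
  fixes I :: "nat set set"
  assumes "omega_ideal I"
  shows "(\<exists>A \<in> matrix_class ell_infty ell_infty.
            \<forall>x \<in> ell_infty. core (mat_apply A x) Fin = core x I)
         \<longleftrightarrow> (I = Fin \<or> isomorphic_copy_Fin_plus_Pow I)"
proof
  assume "\<exists>A \<in> matrix_class ell_infty ell_infty.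
            \<forall>x \<in> ell_infty. core (mat_apply A x) Fin = core x I"
  then obtain A where "core_preserving I A"
    using assms by (auto simp: core_preserving_def)
  then obtain T where T: "I = restr_ideal T"
    using core_preserving.ideal_eq_restr_ideal by blast
  \<comment> \<open>This is properness of the ideal: a finite \<open>T\<close> would put
    \<open>UNIV\<close> into \<open>restr_ideal T\<close>.\<close>
  moreover have "infinite T"
    using assms T by (auto simp: omega_ideal_def restr_ideal_def)
  ultimately show "I = Fin \<or> isomorphic_copy_Fin_plus_Pow I"
    using restr_ideal_cases by blast
next
  assume "I = Fin \<or> isomorphic_copy_Fin_plus_Pow I"
  \<comment> \<open>\<open>Fin\<close> is the case \<open>T = UNIV\<close>.\<close>
  then obtain T where "infinite T" "I = restr_ideal T"
    using Fin_eq_restr_ideal isomorphic_copy_imp_restr_ideal by (metis infinite_UNIV_nat)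
  then show "\<exists>A \<in> matrix_class ell_infty ell_infty.
            \<forall>x \<in> ell_infty. core (mat_apply A x) Fin = core x I"
    using restr_ideal_core_preserved by blast
qed

end
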